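(* (Sign Changing Theorem) Let $\mathfrak B=\{f_1,\dots,f_m\}$ be a finite set of $S$-basic functions, let $W,W'$ be rays in $V$ such that $[W,W']$ is not contained in a single $\mathfrak B$-stratum, let $T_0,T_1,\dots,T_s$ be the sequence of strata met by $[W,W']$ in the order from $W$ to $W'$, and let $Z_1,\dots,Z_s$ be the separating rays for $\mathfrak B$ on $[W,W']$, where $Z_k$ separates $T_{k-1}$ from $T_k$. Let $f_i,f_j\in\mathfrak B$, $i\neq j$. (a) If $f_i(W)<f_j(W)$ and $f_i(W')=f_j(W')$, then there is an index $k$, $0<k\le s$, such that $f_i<f_j$ on $T_0\cup\dots\cup T_{k-1}$, $f_i=f_j$ on $T_k\cup\dots\cup T_s$, and $$\{f_i<f_j\}\cap[W,W']=[W,Z_k[,\qquad \{f_i=f_j\}\cap[W,W']=[Z_k,W'].$$ (b) If $f_i(W)<f_j(W)$ and $f_i(W')>f_j(W')$, then there are indices $k,\ell$, $0<k<\ell\le s$, such that $f_i<f_j$ on $T_0\cup\dots\cup T_{k-1}$, $f_i=f_j$ on $T_k\cup\dots\cup T_{\ell-1}$, $f_i>f_j$ on $T_\ell\cup\dots\cup T_s$, and $$\{f_i<f_j\}\cap[W,W']=[W,Z_k[,\quad \{f_i=f_j\}\cap[W,W']=[Z_k,Z_\ell],\quad \{f_i>f_j\}\cap[W,W']=\,]Z_\ell,W'].$$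
   Context: $R=\{0\}\cup G$ is a bipotent semifield: $G$ is a nontrivial totally ordered abelian group written multiplicatively with unit $e=1$, $0$ is absorbing and smaller than all elements of $G$, and addition is $x+y=\max\{x,y\}$. $R$ is root closed: every element has an $n$-th root in $R$ for all $n\in\mathbb N$. $V$ is an $R$-module with a quadratic form $q:V\to R$ ($q(\lambda x)=\lambda^2q(x)$) and a symmetric bilinear companion $b$ ($q(x+y)=q(x)+q(y)+b(x,y)$); $q$ is anisotropic: $q(x)\neq0$ for $x\ne0$. A ray in $V$ is a class of the equivalence relation on $V\setminus\{0\}$: $x\sim y$ iff $\lambda x=\mu y$ for some $\lambda,\mu\in R\setminus\{0\}$; $\mathrm{ray}(x)$ is the class of $x$, and $\mathrm{Ray}(V)$ is the set of rays. For rays $X=\mathrm{ray}(x)$, $Y=\mathrm{ray}(y)$: $[X,Y]$ is the set of all $\mathrm{ray}(\lambda x+\mu y)$ with $\lambda,\mu\in R$ not both $0$; $[X,Y[\,=[X,Y]\setminus\{Y\}$ and $]X,Y]=[X,Y]\setminus\{X\}$. On $[W,W']$ there is the total ordering $X\le_WY\Leftrightarrow[W,X]\subset[W,Y]$. A subset of $\mathrm{Ray}(V)$ is convex if it contains $[X,Y]$ whenever it contains $X,Y$. $\mathrm{CS}(X,Y)=b(x,y)^2/(q(x)q(y))$ for $x\in X$, $y\in Y$. For a finite set of rays $S=\{Y_1,\dots,Y_n\}$, a function $f:\mathrm{Ray}(V)\to R$ is $S$-basic if $f=\sum_{j=1}^n\gamma_j\mathrm{CS}(Y_j,-)$ with $\gamma_j\in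 R$. A basic $\mathfrak B$-type is a conjunction $T=\bigwedge_{1\le k<\ell\le m}(f_k\,\Box_{k,\ell}\,f_\ell)$ with signs $\Box_{k,\ell}\in\{<,=,>\}$ that is satisfied by some ray; its stratum, also denoted $T$, is the set of all rays satisfying it. The $\mathfrak B$-strata are convex and partition $\mathrm{Ray}(V)$. The strata meeting $[W,W']$ meet it in pairwise disjoint convex sets, which are totally ordered by $\le_W$: $[W,W']\cap T_0<_W[W,W']\cap T_1<_W\dots<_W[W,W']\cap T_s$, with $W\in T_0$, $W'\in T_s$. Pick $W_i\in[W,W']\cap T_i$ with $W_0=W$, $W_s=W'$. For each $i\in\{1,\dots,s\}$ the separating ray $Z_i$ is the unique ray such that either $[W_{i-1},W_i]\cap T_{i-1}=[W_{i-1},Z_i[$ and $[W_{i-1},W_i]\cap T_i=[Z_i,W_i]$, or $[W_{i-1},W_i]\cap T_{i-1}=[W_{i-1},Z_i]$ and $[W_{i-1},W_i]\cap T_i=\,]Z_i,W_i]$; it does not depend on the choice of the $W_i$. $\{f_i<f_j\}$ denotes the set of rays $X$ with $f_i(X)<f_j(X)$, and similarly for $=$, $>$. *)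

theory Defs
  imports Main
begin

section \<open>Bipotent semifields\<close>

text \<open>
  A bipotent semifield is \<open>R = {0} \<union> G\<close> with \<open>G\<close> a nontrivial totally ordered abelian group
  and \<open>x + y = max x y\<close>. That \<open>0\<close> is the least element, and that multiplication is monotone,
  is not postulated: both follow from \<open>x + y = max x y\<close> and the semiring laws (see below).
  As for fields in the library, inversion is totalised by \<open>inverse 0 = 0\<close>.
\<close>

class bipotent_semifield = comm_semiring_1 + linorder + inverse +
  assumes bipotent_add: "x + y = max x y"
    and bipotent_left_inverse: "x \<noteq> 0 \<Longrightarrow> inverse x * x = 1"
    and bipotent_inverse_zero: "inverse 0 = 0"
    and bipotent_divide_inverse: "x / y = x * inverse y"
    and bipotent_nontrivial: "\<exists>x. x \<noteq> 0 \<and> x \<noteq> 1"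
begin

lemma bipotent_zero_le: "0 \<le> x"
  using bipotent_add[of 0 x] by (metis add_0_left max.cobounded1)

lemma bipotent_mult_left_mono: "x \<le> y \<Longrightarrow> z * x \<le> z * y"
  by (metis bipotent_add distrib_left max.absorb2 max.cobounded1)

lemma bipotent_mult_nonzero: "x \<noteq> 0 \<Longrightarrow> y \<noteq> 0 \<Longrightarrow> x * y \<noteq> 0"
  by (metis bipotent_left_inverse mult.assoc mult.left_neutral mult_zero_right)

lemma bipotent_mult_strict_left_mono: "x < y \<Longrightarrow> z \<noteq> 0 \<Longrightarrow> z * x < z * y"
  by (metis bipotent_left_inverse bipotent_mult_left_mono less_le mult.assoc mult.left_neutral)

end


section \<open>Modules with an anisotropic quadratic form\<close>

text \<open>The library locale \<open>module\<close> needs a ring of scalars, hence the following semimodule axioms.\<close>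

locale bipotent_module =
  fixes scale :: "'r::bipotent_semifield \<Rightarrow> 'v::comm_monoid_add \<Rightarrow> 'v"
  assumes scale_add_right: "scale c (x + y) = scale c x + scale c y"
    and scale_add_left: "scale (c + d) x = scale c x + scale d x"
    and scale_scale: "scale c (scale d x) = scale (c * d) x"
    and scale_one: "scale 1 x = x"
    and scale_zero_left: "scale 0 x = 0"
    and scale_zero_right: "scale c 0 = 0"

locale anisotropic_quadratic_module = bipotent_module scale
  for scale :: "'r::bipotent_semifield \<Rightarrow> 'v::comm_monoid_add \<Rightarrow> 'v" +
  fixes q :: "'v \<Rightarrow> 'r" and b :: "'v \<Rightarrow> 'v \<Rightarrow> 'r"
  assumes q_scale: "q (scale c x) = c\<^sup>2 * q x"
    and q_add: "q (x + y) = q x + q y + b x y"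
    and b_sym: "b x y = b y x"
    and b_add_left: "b (x + y) z = b x z + b y z"
    and b_scale_left: "b (scale c x) y = c * b x y"
    and q_anisotropic: "x \<noteq> 0 \<Longrightarrow> q x \<noteq> 0"


section \<open>Rays and intervals of rays\<close>

definition ray_rel :: "('r::bipotent_semifield \<Rightarrow> 'v::comm_monoid_add \<Rightarrow> 'v) \<Rightarrow> ('v \<times> 'v) set" where
  "ray_rel scale =
     {(x, y). x \<noteq> 0 \<and> y \<noteq> 0 \<and> (\<exists>c d. c \<noteq> 0 \<and> d \<noteq> 0 \<and> scale c x = scale d y)}"

definition ray :: "('r::bipotent_semifield \<Rightarrow> 'v::comm_monoid_add \<Rightarrow> 'v) \<Rightarrow> 'v \<Rightarrow> 'v set" where
  "ray scale x = ray_rel scale `` {x}"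

definition rays :: "('r::bipotent_semifield \<Rightarrow> 'v::comm_monoid_add \<Rightarrow> 'v) \<Rightarrow> 'v set set" where
  "rays scale = (UNIV - {0}) // ray_rel scale"

text \<open>
  The interval \<open>[X,Y]\<close>. All representatives \<open>x \<in> X\<close>, \<open>y \<in> Y\<close> are allowed; changing them only
  rescales the coefficients, so the set is the one obtained from any fixed pair.
\<close>

definition seg :: "('r::bipotent_semifield \<Rightarrow> 'v::comm_monoid_add \<Rightarrow> 'v) \<Rightarrow> 'v set \<Rightarrow> 'v set \<Rightarrow> 'v set set"
  where "seg scale X Y =
    {ray scale (scale c x + scale d y) | c d x y. x \<in> X \<and> y \<in> Y \<and> (c \<noteq> 0 \<or> d \<noteq> 0)}"

text \<open>\<open>seg_ro\<close> is \<open>[X,Y[\<close> and \<open>seg_lo\<close> is \<open>]X,Y]\<close>.\<close>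

definition seg_ro :: "('r::bipotent_semifield \<Rightarrow> 'v::comm_monoid_add \<Rightarrow> 'v) \<Rightarrow> 'v set \<Rightarrow> 'v set \<Rightarrow> 'v set set"
  where "seg_ro scale X Y = seg scale X Y - {Y}"

definition seg_lo :: "('r::bipotent_semifield \<Rightarrow> 'v::comm_monoid_add \<Rightarrow> 'v) \<Rightarrow> 'v set \<Rightarrow> 'v set \<Rightarrow> 'v set set"
  where "seg_lo scale X Y = seg scale X Y - {X}"

definition ray_le :: "('r::bipotent_semifield \<Rightarrow> 'v::comm_monoid_add \<Rightarrow> 'v) \<Rightarrow> 'v set \<Rightarrow> 'v set \<Rightarrow> 'v set \<Rightarrow> bool"
  where "ray_le scale W X Y \<longleftrightarrow> seg scale W X \<subseteq> seg scale W Y"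

definition ray_less :: "('r::bipotent_semifield \<Rightarrow> 'v::comm_monoid_add \<Rightarrow> 'v) \<Rightarrow> 'v set \<Rightarrow> 'v set \<Rightarrow> 'v set \<Rightarrow> bool"
  where "ray_less scale W X Y \<longleftrightarrow> ray_le scale W X Y \<and> X \<noteq> Y"


section \<open>CS-ratios and basic functions\<close>

text \<open>The value below does not depend on the representatives, see \<open>CS_ray\<close>.\<close>

definition CS :: "('v \<Rightarrow> 'r::bipotent_semifield) \<Rightarrow> ('v \<Rightarrow> 'v \<Rightarrow> 'r) \<Rightarrow> 'v set \<Rightarrow> 'v set \<Rightarrow> 'r" where
  "CS q b X Y = (THE c. \<exists>x\<in>X. \<exists>y\<in>Y. c = (b x y)\<^sup>2 / (q x * q y))"

text \<open>
  Functions on rays are total functions on \<open>'v set\<close>; only their values on \<open>rays scale\<close> matter.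
\<close>

definition basic_fun ::
  "('r::bipotent_semifield \<Rightarrow> 'v::comm_monoid_add \<Rightarrow> 'v) \<Rightarrow> ('v \<Rightarrow> 'r) \<Rightarrow> ('v \<Rightarrow> 'v \<Rightarrow> 'r) \<Rightarrow>
     'v set set \<Rightarrow> ('v set \<Rightarrow> 'r) \<Rightarrow> bool" where
  "basic_fun scale q b S f \<longleftrightarrow>
     (\<exists>\<gamma>. \<forall>X\<in>rays scale. f X = (\<Sum>Y\<in>S. \<gamma> Y * CS q b Y X))"


section \<open>Strata and separating rays\<close>

text \<open>The family \<open>f\<^sub>1, \<dots>, f\<^sub>m\<close> is the restriction of \<open>f\<close> to the indices \<open>1..m\<close>.\<close>

definition stratum ::
  "('r::bipotent_semifield \<Rightarrow> 'v::comm_monoid_add \<Rightarrow> 'v) \<Rightarrow> nat \<Rightarrow> (nat \<Rightarrow> 'v set \<Rightarrow> 'r) \<Rightarrow>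
     'v set set \<Rightarrow> bool" where
  "stratum scale m f T \<longleftrightarrow>
     (\<exists>box :: nat \<Rightarrow> nat \<Rightarrow> 'r \<Rightarrow> 'r \<Rightarrow> bool.
        (\<forall>k l. 1 \<le> k \<and> k < l \<and> l \<le> m \<longrightarrow> box k l \<in> {(<), (=), (>)}) \<and>
        T = {X \<in> rays scale. \<forall>k l. 1 \<le> k \<and> k < l \<and> l \<le> m \<longrightarrow> box k l (f k X) (f l X)} \<and>
        T \<noteq> {})"

text \<open>\<open>T 0, \<dots>, T s\<close> are precisely the strata met by \<open>[W,W']\<close>, listed in the order from \<open>W\<close> to \<open>W'\<close>.\<close>

definition strata_sequence ::
  "('r::bipotent_semifield \<Rightarrow> 'v::comm_monoid_add \<Rightarrow> 'v) \<Rightarrow> nat \<Rightarrow> (nat \<Rightarrow> 'v set \<Rightarrow> 'r) \<Rightarrow>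
     'v set \<Rightarrow> 'v set \<Rightarrow> nat \<Rightarrow> (nat \<Rightarrow> 'v set set) \<Rightarrow> bool" where
  "strata_sequence scale m f W W' s T \<longleftrightarrow>
     T ` {0..s} = {A. stratum scale m f A \<and> seg scale W W' \<inter> A \<noteq> {}} \<and>
     (\<forall>i j. i < j \<and> j \<le> s \<longrightarrow>
        (\<forall>X \<in> seg scale W W' \<inter> T i. \<forall>Y \<in> seg scale W W' \<inter> T j. ray_less scale W X Y))"

text \<open>\<open>Z\<close> separates the strata \<open>A\<close> and \<open>B\<close> on \<open>[X,Y]\<close>, where \<open>X \<in> A\<close> and \<open>Y \<in> B\<close>.\<close>

definition separates ::
  "('r::bipotent_semifield \<Rightarrow> 'v::comm_monoid_add \<Rightarrow> 'v) \<Rightarrow> 'v set \<Rightarrow> 'v set \<Rightarrow>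
     'v set set \<Rightarrow> 'v set set \<Rightarrow> 'v set \<Rightarrow> bool" where
  "separates scale X Y A B Z \<longleftrightarrow> Z \<in> rays scale \<and>
     (seg scale X Y \<inter> A = seg_ro scale X Z \<and> seg scale X Y \<inter> B = seg scale Z Y \<or>
      seg scale X Y \<inter> A = seg scale X Z \<and> seg scale X Y \<inter> B = seg_lo scale Z Y)"

text \<open>
  \<open>Z 1, \<dots>, Z s\<close> are the separating rays on \<open>[W,W']\<close>, computed from some choice of
  \<open>P i \<in> [W,W'] \<inter> T i\<close> with \<open>P 0 = W\<close> and \<open>P s = W'\<close> (the choice is immaterial).
\<close>

definition separating_rays ::
  "('r::bipotent_semifield \<Rightarrow> 'v::comm_monoid_add \<Rightarrow> 'v) \<Rightarrow> 'v set \<Rightarrow> 'v set \<Rightarrow>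
     nat \<Rightarrow> (nat \<Rightarrow> 'v set set) \<Rightarrow> (nat \<Rightarrow> 'v set) \<Rightarrow> bool" where
  "separating_rays scale W W' s T Z \<longleftrightarrow>
     (\<exists>P. P 0 = W \<and> P s = W' \<and> (\<forall>i\<le>s. P i \<in> seg scale W W' \<inter> T i) \<and>
        (\<forall>i\<in>{1..s}. separates scale (P (i - 1)) (P i) (T (i - 1)) (T i) (Z i)))"


section \<open>Well-definedness of the notions above\<close>

context bipotent_module
begin

lemma scale_nonzero: "c \<noteq> 0 \<Longrightarrow> x \<noteq> 0 \<Longrightarrow> scale c x \<noteq> 0"
  by (metis bipotent_left_inverse scale_one scale_scale scale_zero_right)

lemma sum_nonzero:
  fixes x y :: 'v
  assumes "x \<noteq> 0"
  shows "x + y \<noteq> 0"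
proof
  assume xy: "x + y = 0"
  have "x + x = scale (1 + 1) x" by (simp only: scale_add_left scale_one)
  also have "\<dots> = x" by (simp only: bipotent_add max.idem scale_one)
  finally have "x + x = x" .
  then have "x + (x + y) = x + y" by (simp only: add.assoc[symmetric])
  with xy assms show False by simp
qed

lemma equiv_ray_rel: "equiv (UNIV - {0}) (ray_rel scale)"
proof (rule equivI)
  show "trans (ray_rel scale)"
  proof (rule transI)
    fix x y z assume xy: "(x, y) \<in> ray_rel scale" and yz: "(y, z) \<in> ray_rel scale"
    obtain c d where 1: "c \<noteq> 0" "d \<noteq> 0" "scale c x = scale d y"
      using xy by (auto simp: ray_rel_def)
    obtain c' d' where 2: "c' \<noteq> 0" "d' \<noteq> 0" "scale c' y = scale d' z"
      using yz by (auto simp: ray_rel_def)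
    have "scale (c' * c) x = scale (d * d') z"
      by (metis 1(3) 2(3) mult.commute scale_scale)
    moreover have "c' * c \<noteq> 0" "d * d' \<noteq> 0" using 1 2 by (simp_all only: bipotent_mult_nonzero not_False_eq_True)
    moreover have "x \<noteq> 0" "z \<noteq> 0" using xy yz by (auto simp only: ray_rel_def mem_Collect_eq case_prod_conv)
    ultimately show "(x, z) \<in> ray_rel scale"
      unfolding ray_rel_def mem_Collect_eq case_prod_conv by metis
  qed
next
  show "ray_rel scale \<subseteq> (UNIV - {0}) \<times> (UNIV - {0})" by (auto simp: ray_rel_def)
  show "refl_on (UNIV - {0}) (ray_rel scale)"
    by (auto simp: ray_rel_def refl_on_def intro!: exI[of _ 1])
  show "sym (ray_rel scale)"
    unfolding sym_def ray_rel_def mem_Collect_eq case_prod_conv by metis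
qed

end

context anisotropic_quadratic_module
begin

lemma CS_scale_left:
  assumes "c \<noteq> 0" "x \<noteq> 0" "y \<noteq> 0"
  shows "(b (scale c x) y)\<^sup>2 / (q (scale c x) * q y) = (b x y)\<^sup>2 / (q x * q y)"
proof -
  have nz: "q x * q y \<noteq> 0" "c\<^sup>2 * (q x * q y) \<noteq> 0"
    using assms by (simp_all only: power2_eq_square bipotent_mult_nonzero q_anisotropic not_False_eq_True)
  define u where "u = inverse (c\<^sup>2 * (q x * q y))"
  define v where "v = inverse (q x * q y)"
  have u: "u * (c\<^sup>2 * (q x * q y)) = 1" and v: "v * (q x * q y) = 1"
    using nz by (simp_all add: u_def v_def bipotent_left_inverse)
  have "c\<^sup>2 * u = c\<^sup>2 * u * (v * (q x * q y))" by (simp add: v)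
  also have "\<dots> = (u * (c\<^sup>2 * (q x * q y))) * v" by (simp add: ac_simps)
  finally have "c\<^sup>2 * u = v" by (simp add: u)
  have "(b (scale c x) y)\<^sup>2 / (q (scale c x) * q y) = (c * b x y)\<^sup>2 * u"
    by (simp add: bipotent_divide_inverse b_scale_left q_scale u_def ac_simps)
  also have "\<dots> = (b x y)\<^sup>2 * (c\<^sup>2 * u)" by (simp add: power_mult_distrib ac_simps)
  finally show ?thesis by (simp add: \<open>c\<^sup>2 * u = v\<close> bipotent_divide_inverse v_def)
qed

lemma CS_ray_rel_left:
  assumes "(x, x') \<in> ray_rel scale" "y \<noteq> 0"
  shows "(b x y)\<^sup>2 / (q x * q y) = (b x' y)\<^sup>2 / (q x' * q y)"
proof -
  obtain c d where "x \<noteq> 0" "x' \<noteq> 0" "c \<noteq> 0" "d \<noteq> 0" "scale c x = scale d x'"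
    using assms(1) by (auto simp only: ray_rel_def mem_Collect_eq case_prod_conv)
  then show ?thesis using CS_scale_left[of c x y] CS_scale_left[of d x' y] assms(2) by simp
qed

lemma CS_ray:
  assumes "X \<in> rays scale" "Y \<in> rays scale" "x \<in> X" "y \<in> Y"
  shows "CS q b X Y = (b x y)\<^sup>2 / (q x * q y)"
proof -
  have "c = (b x y)\<^sup>2 / (q x * q y)"
    if "x' \<in> X" "y' \<in> Y" "c = (b x' y')\<^sup>2 / (q x' * q y')" for c x' y'
  proof -
    have rel: "(x', x) \<in> ray_rel scale" "(y', y) \<in> ray_rel scale"
      using in_quotient_imp_in_rel[OF equiv_ray_rel, of X x' x]
        in_quotient_imp_in_rel[OF equiv_ray_rel, of Y y' y] assms that
      by (simp_all add: rays_def)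
    then have nz: "x \<noteq> 0" "y' \<noteq> 0" by (auto simp: ray_rel_def)
    have "c = (b x y')\<^sup>2 / (q x * q y')" using CS_ray_rel_left[OF rel(1) nz(2)] that(3) by simp
    also have "\<dots> = (b y' x)\<^sup>2 / (q y' * q x)" by (simp only: b_sym[of x y'] mult.commute[of "q x"])
    also have "\<dots> = (b y x)\<^sup>2 / (q y * q x)" by (rule CS_ray_rel_left[OF rel(2) nz(1)])
    finally show ?thesis by (simp only: b_sym[of x y] mult.commute[of "q x"])
  qed
  note unique = this
  show ?thesis
    unfolding CS_def
  proof (rule the_equality)
    show "\<exists>x'\<in>X. \<exists>y'\<in>Y. (b x y)\<^sup>2 / (q x * q y) = (b x' y')\<^sup>2 / (q x' * q y')"
      using assms(3,4) by blast
  qed (elim bexE, rule unique)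
qed

end

end

theory Submission
  imports Defs
begin

text \<open>
  Squaring is additive in a bipotent semifield, so a basic function has the form
  \<open>ray x \<mapsto> N x / q x\<close>, where the numerator \<open>N\<close> is a quasilinear form: \<open>N (x + y) = N x + N y\<close>
  and \<open>N (c x) = c\<^sup>2 N x\<close> (\<open>basic_fun_quasilinear_quotient\<close>). All basic functions share the
  denominator \<open>q\<close>, so comparing \<open>f\<^sub>i\<close> with \<open>f\<^sub>j\<close> on \<open>[W,W']\<close> means comparing
  \<open>max (\<lambda>\<^sup>2 A) (\<mu>\<^sup>2 B)\<close> with \<open>max (\<lambda>\<^sup>2 A') (\<mu>\<^sup>2 B')\<close> for constants \<open>A, B, A', B'\<close>. Consequently
  \<open>{f\<^sub>i < f\<^sub>j}\<close>, \<open>{f\<^sub>i \<le> f\<^sub>j}\<close> and \<open>{f\<^sub>i = f\<^sub>j}\<close> are convex (\<open>seg_less\<close>, \<open>seg_le\<close>,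
  \<open>seg_eq\<close>), and by root closure an interval from \<open>{f\<^sub>i < f\<^sub>j}\<close> to \<open>{f\<^sub>i > f\<^sub>j}\<close>
  contains a ray with \<open>f\<^sub>i = f\<^sub>j\<close> (\<open>seg_crossing\<close>).

  The sign of \<open>f\<^sub>i\<close> against \<open>f\<^sub>j\<close> is constant on a stratum. By convexity, if \<open>f\<^sub>i < f\<^sub>j\<close> at \<open>W\<close>, the
  strata in \<open>{f\<^sub>i < f\<^sub>j}\<close> form an initial part of the sequence \<open>T\<^sub>0, \<dots>, T\<^sub>s\<close>, and so do those on
  which \<open>f\<^sub>i \<le> f\<^sub>j\<close>; the crossing ray shows that the sign cannot jump from \<open><\<close> to \<open>>\<close>. This gives
  the indices \<open>k\<close> and \<open>l\<close>.

  It remains to decide on which side a separating ray lies. If \<open>f\<^sub>i < f\<^sub>j\<close> before \<open>Z\<close> and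
  \<open>f\<^sub>i = f\<^sub>j\<close> after it, then \<open>Z\<close> itself lies in \<open>{f\<^sub>i = f\<^sub>j}\<close>, because \<open>{f\<^sub>i < f\<^sub>j}\<close> has no last
  ray (\<open>no_last_less\<close>). This is where density of the order and anisotropy of \<open>q\<close> enter: rays
  themselves need not be densely ordered on an interval, but the sign cannot change from \<open><\<close> to
  \<open>=\<close> across a gap. Reversing the interval and exchanging \<open>f\<^sub>i\<close> and \<open>f\<^sub>j\<close> settles the
  change from \<open>=\<close> to \<open>>\<close>. The interval identities then follow by cutting \<open>[W,W']\<close> at the
  separating rays (\<open>seg_split\<close>, \<open>seg_nested\<close>).
\<close>

section \<open>Squares in a bipotent semifield\<close>

lemma bipotent_square_mono:
  fixes x y :: "'r::bipotent_semifield"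
  assumes "x \<le> y"
  shows "x\<^sup>2 \<le> y\<^sup>2"
proof -
  have "x * x \<le> x * y" by (rule bipotent_mult_left_mono[OF assms])
  also have "\<dots> \<le> y * y"
    using bipotent_mult_left_mono[OF assms, of y] by (simp only: mult.commute)
  finally show ?thesis by (simp only: power2_eq_square)
qed

text \<open>The mixed term \<open>x y\<close> never exceeds the larger square, so squaring is additive.\<close>

lemma bipotent_square_add:
  fixes x y :: "'r::bipotent_semifield"
  shows "(x + y)\<^sup>2 = x\<^sup>2 + y\<^sup>2"
proof (cases "x \<le> y")
  case True
  then show ?thesis using bipotent_square_mono[of x y] by (simp only: bipotent_add max.absorb2)
next
  case False
  then have "y \<le> x" by simp
  then show ?thesis using bipotent_square_mono[of y x] by (simp only: bipotent_add max.absorb1)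
qed

lemma bipotent_square_nonzero:
  fixes c :: "'r::bipotent_semifield"
  shows "c \<noteq> 0 \<Longrightarrow> c\<^sup>2 \<noteq> 0"
  by (simp only: power2_eq_square bipotent_mult_nonzero not_False_eq_True)

lemma bipotent_pos_iff:
  fixes x :: "'r::bipotent_semifield"
  shows "0 < x \<longleftrightarrow> x \<noteq> 0"
  using bipotent_zero_le[of x] by (metis less_le)

lemma bipotent_inverse_nonzero:
  fixes x :: "'r::bipotent_semifield"
  assumes "x \<noteq> 0"
  shows "inverse x \<noteq> 0"
  using bipotent_left_inverse[OF assms] by (metis mult_zero_left zero_neq_one)

lemma bipotent_mult_left_less_iff:
  fixes x y z :: "'r::bipotent_semifield"
  assumes "z \<noteq> 0"
  shows "z * x < z * y \<longleftrightarrow> x < y"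
  using assms by (metis bipotent_mult_left_mono bipotent_mult_strict_left_mono not_less)

lemma bipotent_mult_left_cancel:
  fixes x y z :: "'r::bipotent_semifield"
  assumes "z \<noteq> 0"
  shows "z * x = z * y \<longleftrightarrow> x = y"
  using assms by (metis bipotent_left_inverse mult.assoc mult.left_neutral)

lemma bipotent_divide_less_iff:
  fixes x y z :: "'r::bipotent_semifield"
  assumes "z \<noteq> 0"
  shows "x / z < y / z \<longleftrightarrow> x < y"
  using bipotent_mult_left_less_iff[OF bipotent_inverse_nonzero[OF assms], of x y]
  by (simp only: bipotent_divide_inverse mult.commute)

lemma exists_gt_one: "\<exists>u::'r::bipotent_semifield. 1 < u"
proof -
  obtain x :: 'r where x: "x \<noteq> 0" "x \<noteq> 1" using bipotent_nontrivial by blast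
  show ?thesis
  proof (cases "1 < x")
    case False
    then have "x < 1" using x by simp
    then have "inverse x * x < inverse x * 1"
      by (rule bipotent_mult_strict_left_mono[OF _ bipotent_inverse_nonzero[OF x(1)]])
    then show ?thesis using bipotent_left_inverse[OF x(1)] by auto
  qed blast
qed

lemma exists_square_multiple:
  fixes x y :: "'r::bipotent_semifield"
  assumes "\<And>x::'r. \<exists>y. y\<^sup>2 = x" and "y \<noteq> 0"
  obtains d where "d\<^sup>2 * y = x"
  using assms bipotent_left_inverse[OF assms(2)] by (metis mult.assoc mult.right_neutral)

text \<open>
  Square roots make the order dense: the geometric mean \<open>sqrt (x y)\<close> lies strictly between
  \<open>x\<close> and \<open>y\<close>. For \<open>x = 0\<close>, where this mean is \<open>0\<close>, nontriviality of the group is used instead.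
\<close>

lemma bipotent_dense:
  fixes x y :: "'r::bipotent_semifield"
  assumes roots: "\<And>x::'r. \<exists>y. y\<^sup>2 = x" and "x < y"
  obtains t where "x < t" "t < y"
proof (cases "x = 0")
  case True
  obtain u :: 'r where u: "1 < u" using exists_gt_one by blast
  then have u0: "u \<noteq> 0" using bipotent_zero_le[of "1::'r"] by auto
  have y0: "y \<noteq> 0" using assms(2) True by auto
  let ?t = "y * inverse u"
  have t0: "?t \<noteq> 0" by (rule bipotent_mult_nonzero[OF y0 bipotent_inverse_nonzero[OF u0]])
  have "?t * 1 < ?t * u" by (rule bipotent_mult_strict_left_mono[OF u t0])
  then have "?t < y" by (simp add: mult.assoc bipotent_left_inverse[OF u0])
  then show ?thesis using that t0 True bipotent_pos_iff by blast
next
  case False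
  obtain t where t: "t\<^sup>2 = x * y" using roots by blast
  have y0: "y \<noteq> 0" using assms(2) bipotent_zero_le[of x] by auto
  have lo: "x\<^sup>2 < x * y"
    using bipotent_mult_strict_left_mono[OF assms(2) False] by (simp only: power2_eq_square)
  have hi: "x * y < y\<^sup>2"
    using bipotent_mult_strict_left_mono[OF assms(2) y0] by (simp only: power2_eq_square mult.commute)
  have "x < t" using lo t bipotent_square_mono[of t x] by (metis not_less)
  moreover have "t < y" using hi t bipotent_square_mono[of y t] by (metis not_less)
  ultimately show ?thesis by (rule that)
qed


section \<open>Intervals of rays\<close>

context bipotent_module
begin

lemma mem_ray_iff:
  assumes "x \<noteq> 0"
  shows "y \<in> ray scale x \<longleftrightarrow> (\<exists>c. c \<noteq> 0 \<and> y = scale c x)"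
proof
  assume "y \<in> ray scale x"
  then obtain c d where cd: "c \<noteq> 0" "d \<noteq> 0" "scale c x = scale d y"
    by (auto simp: ray_def ray_rel_def)
  then have "y = scale (inverse d * c) x"
    by (metis bipotent_left_inverse scale_one scale_scale)
  moreover have "inverse d * c \<noteq> 0"
    by (rule bipotent_mult_nonzero[OF bipotent_inverse_nonzero[OF cd(2)] cd(1)])
  ultimately show "\<exists>c. c \<noteq> 0 \<and> y = scale c x" by blast
next
  assume "\<exists>c. c \<noteq> 0 \<and> y = scale c x"
  then obtain c where c: "c \<noteq> 0" "y = scale c x" by blast
  have "scale c x = scale 1 y" by (simp only: c(2) scale_one)
  then have "(x, y) \<in> ray_rel scale"
    using c assms scale_nonzero[OF c(1) assms]
    unfolding ray_rel_def mem_Collect_eq case_prod_conv by (metis zero_neq_one)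
  then show "y \<in> ray scale x" by (simp add: ray_def)
qed

lemma ray_in_rays: "x \<noteq> 0 \<Longrightarrow> ray scale x \<in> rays scale"
  by (auto simp: rays_def ray_def quotient_def)

lemma raysE:
  assumes "X \<in> rays scale"
  obtains x where "x \<noteq> 0" "X = ray scale x"
  using assms by (auto simp: rays_def ray_def quotient_def)

lemma ray_self: "x \<noteq> 0 \<Longrightarrow> x \<in> ray scale x"
  unfolding mem_ray_iff by (metis scale_one zero_neq_one)

lemma ray_scale:
  assumes "x \<noteq> 0" "c \<noteq> 0"
  shows "ray scale (scale c x) = ray scale x"
  using equiv_class_eq[OF equiv_ray_rel, of x "scale c x"] mem_ray_iff[OF assms(1), of "scale c x"] assms
  by (auto simp: ray_def)

lemma combination_nonzero:
  assumes "x \<noteq> 0" "y \<noteq> 0" "c \<noteq> 0 \<or> d \<noteq> 0"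
  shows "scale c x + scale d y \<noteq> 0"
  using assms by (metis add.commute scale_nonzero sum_nonzero)

lemma seg_ray:
  assumes "x \<noteq> 0" "y \<noteq> 0"
  shows "seg scale (ray scale x) (ray scale y) = {ray scale (scale c x + scale d y) | c d. c \<noteq> 0 \<or> d \<noteq> 0}"
proof (intro equalityI subsetI)
  fix Z assume "Z \<in> seg scale (ray scale x) (ray scale y)"
  then obtain c d x' y' where Z: "Z = ray scale (scale c x' + scale d y')"
    "x' \<in> ray scale x" "y' \<in> ray scale y" "c \<noteq> 0 \<or> d \<noteq> 0"
    unfolding seg_def by blast
  obtain a e where ae: "a \<noteq> 0" "x' = scale a x" "e \<noteq> 0" "y' = scale e y"
    using Z(2,3) assms by (auto simp: mem_ray_iff)
  have "Z = ray scale (scale (c * a) x + scale (d * e) y)"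
    by (simp only: Z(1) ae(2,4) scale_scale)
  moreover have "c * a \<noteq> 0 \<or> d * e \<noteq> 0"
    using Z(4) ae bipotent_mult_nonzero by metis
  ultimately show "Z \<in> {ray scale (scale c x + scale d y) | c d. c \<noteq> 0 \<or> d \<noteq> 0}" by blast
next
  fix Z assume "Z \<in> {ray scale (scale c x + scale d y) | c d. c \<noteq> 0 \<or> d \<noteq> 0}"
  then show "Z \<in> seg scale (ray scale x) (ray scale y)"
    unfolding seg_def using ray_self[OF assms(1)] ray_self[OF assms(2)] by blast
qed

lemma seg_sym: "seg scale X Y = seg scale Y X"
proof -
  have "seg scale X Y \<subseteq> seg scale Y X" for X Y
  proof
    fix Z assume "Z \<in> seg scale X Y"
    then obtain c d x y where Z: "Z = ray scale (scale c x + scale d y)" "x \<in> X" "y \<in> Y" "c \<noteq> 0 \<or> d \<noteq> 0"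
      unfolding seg_def by blast
    have "Z = ray scale (scale d y + scale c x)" by (simp only: Z(1) add.commute)
    then show "Z \<in> seg scale Y X" unfolding seg_def using Z(2-4) by blast
  qed
  then show ?thesis by blast
qed

lemma left_in_seg:
  assumes "X \<in> rays scale" "Y \<in> rays scale"
  shows "X \<in> seg scale X Y"
proof -
  obtain x y where xy: "x \<noteq> 0" "X = ray scale x" "y \<noteq> 0" "Y = ray scale y"
    using assms raysE by metis
  have X: "X = ray scale (scale 1 x + scale 0 y)"
    by (simp only: xy(2) scale_one scale_zero_left add_0_right)
  show ?thesis
    unfolding xy(4) by (subst (2) xy(2), unfold seg_ray[OF xy(1,3)] mem_Collect_eq)
      (intro exI[of _ 1] exI[of _ 0] conjI disjI1 one_neq_zero X)
qed

lemma right_in_seg: "X \<in> rays scale \<Longrightarrow> Y \<in> rays scale \<Longrightarrow> Y \<in> seg scale X Y"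
  using left_in_seg seg_sym by metis

lemma seg_subset_rays:
  assumes "X \<in> rays scale" "Y \<in> rays scale"
  shows "seg scale X Y \<subseteq> rays scale"
proof -
  obtain x y where xy: "x \<noteq> 0" "X = ray scale x" "y \<noteq> 0" "Y = ray scale y"
    using assms raysE by metis
  show ?thesis using seg_ray[OF xy(1,3)] xy ray_in_rays combination_nonzero[OF xy(1,3)] by auto
qed

lemma seg_subset_seg:
  assumes "U \<in> rays scale" "V \<in> rays scale" "X \<in> seg scale U V" "Y \<in> seg scale U V"
  shows "seg scale X Y \<subseteq> seg scale U V"
proof
  fix Z assume Z: "Z \<in> seg scale X Y"
  obtain u v where uv: "u \<noteq> 0" "U = ray scale u" "v \<noteq> 0" "V = ray scale v"
    using assms raysE by metis
  obtain c d where X: "X = ray scale (scale c u + scale d v)" "c \<noteq> 0 \<or> d \<noteq> 0"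
    using assms(3) seg_ray[OF uv(1,3)] uv by auto
  obtain c' d' where Y: "Y = ray scale (scale c' u + scale d' v)" "c' \<noteq> 0 \<or> d' \<noteq> 0"
    using assms(4) seg_ray[OF uv(1,3)] uv by auto
  obtain a e where ae: "a \<noteq> 0 \<or> e \<noteq> 0"
    "Z = ray scale (scale a (scale c u + scale d v) + scale e (scale c' u + scale d' v))"
    using Z seg_ray[OF combination_nonzero[OF uv(1,3) X(2)] combination_nonzero[OF uv(1,3) Y(2)]]
    unfolding X(1) Y(1) by blast
  have "Z = ray scale (scale (a * c + e * c') u + scale (a * d + e * d') v)"
    unfolding ae(2) by (simp only: scale_add_right scale_add_left scale_scale ac_simps)
  moreover have "a * c + e * c' \<noteq> 0 \<or> a * d + e * d' \<noteq> 0"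
  proof -
    have *: "x + y \<noteq> 0" if "x \<noteq> 0 \<or> y \<noteq> 0" for x y :: 'r
      using that unfolding bipotent_add by (metis bipotent_zero_le max_def order_antisym)
    show ?thesis using ae(1) X(2) Y(2) * bipotent_mult_nonzero by metis
  qed
  ultimately show "Z \<in> seg scale U V" using seg_ray[OF uv(1,3)] uv by blast
qed

lemma scale_absorb:
  assumes "c \<le> d"
  shows "scale c x + scale d x = scale d x"
  by (metis assms bipotent_add max.absorb2 scale_add_left)

text \<open>
  Up to scaling, \<open>P\<close> is \<open>U\<close> or is spanned by \<open>p = a u + v\<close>, and \<open>Z\<close> is spanned by
  \<open>z = c p + d v = c a u + (c + d) v\<close>. If \<open>d \<le> c\<close>, then \<open>z = c p\<close>. Otherwise \<open>z = c a u + d v\<close> with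
  \<open>c < d\<close>, and raising the coefficient of \<open>u\<close> to \<open>d a\<close> gives \<open>d a u + z = d p\<close>.
\<close>

lemma seg_nested:
  assumes "U \<in> rays scale" "V \<in> rays scale" "P \<in> seg scale U V" "Z \<in> seg scale P V"
  shows "P \<in> seg scale U Z"
proof -
  obtain u v where uv: "u \<noteq> 0" "U = ray scale u" "v \<noteq> 0" "V = ray scale v"
    using assms raysE by metis
  have rays: "P \<in> rays scale" "Z \<in> rays scale"
    using assms seg_subset_rays by (meson in_mono)+
  obtain a e where P: "P = ray scale (scale a u + scale e v)" "a \<noteq> 0 \<or> e \<noteq> 0"
    using assms(3) seg_ray[OF uv(1,3)] uv by auto
  define p where "p = scale a u + scale e v"
  have p0: "p \<noteq> 0" unfolding p_def by (rule combination_nonzero[OF uv(1,3) P(2)])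
  show ?thesis
  proof (cases "e = 0")
    case True
    then have "a \<noteq> 0" "P = ray scale (scale a u)" using P by (simp_all add: scale_zero_left)
    then have "P = U" using ray_scale uv by metis
    then show ?thesis using left_in_seg rays by metis
  next
    case e: False
    obtain c d where Z: "Z = ray scale (scale c p + scale d v)" "c \<noteq> 0 \<or> d \<noteq> 0"
      using assms(4) seg_ray[OF p0 uv(3)] P(1) uv(4) by (auto simp: p_def)
    define z where "z = scale c p + scale d v"
    have z0: "z \<noteq> 0" unfolding z_def by (rule combination_nonzero[OF p0 uv(3) Z(2)])
    have z: "z = scale (c * a) u + (scale (c * e) v + scale d v)"
      by (simp only: z_def p_def scale_add_right scale_scale add.assoc)
    show ?thesis
    proof (cases "d \<le> c * e")
      case True
      then have "z = scale (c * a) u + scale (c * e) v"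
        unfolding z using scale_absorb[of d "c * e" v] by (simp only: add.commute)
      then have zp: "z = scale c p" by (simp only: p_def scale_add_right scale_scale)
      with z0 have "c \<noteq> 0" using scale_zero_left by metis
      then have "Z = P" using Z(1) P(1) zp ray_scale[OF p0] unfolding z_def p_def by metis
      then show ?thesis using right_in_seg assms(1) rays by metis
    next
      case False
      then have less: "c * e \<le> d" by simp
      then have z': "z = scale (c * a) u + scale d v"
        unfolding z using scale_absorb[of "c * e" d v] by simp
      let ?g = "d * inverse e"
      have d0: "d \<noteq> 0" using False bipotent_zero_le by metis
      have g0: "?g \<noteq> 0" by (rule bipotent_mult_nonzero[OF d0 bipotent_inverse_nonzero[OF e]])
      have ge: "?g * e = d" by (simp add: mult.assoc bipotent_left_inverse[OF e])
      have "c \<le> ?g"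
      proof -
        have "inverse e * (c * e) \<le> inverse e * d" by (rule bipotent_mult_left_mono[OF less])
        then show ?thesis using bipotent_left_inverse[OF e]
          by (metis mult.assoc mult.commute mult.right_neutral)
      qed
      then have ca: "c * a \<le> ?g * a"
        using bipotent_mult_left_mono[of c ?g a] by (simp only: mult.commute)
      have "scale (?g * a) u + scale 1 z = scale (c * a) u + scale (?g * a) u + scale d v"
        by (simp only: scale_one z' ac_simps)
      also have "\<dots> = scale (?g * a) u + scale (?g * e) v"
        by (simp only: scale_absorb[OF ca] ge)
      also have "\<dots> = scale ?g p" by (simp only: p_def scale_add_right scale_scale)
      finally have "ray scale (scale (?g * a) u + scale 1 z) = P"
        using ray_scale[OF p0 g0] P(1) unfolding p_def by simp
      then show ?thesis
        using seg_ray[OF uv(1) z0] uv(2) Z(1) unfolding z_def[symmetric]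
        by (metis (mono_tags, lifting) mem_Collect_eq zero_neq_one)
    qed
  qed
qed

text \<open>
  With \<open>z = a u + e v\<close>, a combination \<open>c u + d v\<close> lies on the side of \<open>u\<close> or of \<open>v\<close> according to
  which of the ratios \<open>c / d\<close> and \<open>a / e\<close> is larger; the test is written multiplicatively.
\<close>

lemma seg_split:
  assumes "U \<in> rays scale" "V \<in> rays scale" "Z \<in> seg scale U V"
  shows "seg scale U V = seg scale U Z \<union> seg scale Z V"
proof
  show "seg scale U Z \<union> seg scale Z V \<subseteq> seg scale U V"
    using seg_subset_seg assms left_in_seg right_in_seg by (metis Un_least)
next
  show "seg scale U V \<subseteq> seg scale U Z \<union> seg scale Z V"
  proof
    fix X assume X: "X \<in> seg scale U V"
    obtain u v where uv: "u \<noteq> 0" "U = ray scale u" "v \<noteq> 0" "V = ray scale v"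
      using assms raysE by metis
    obtain a e where Z: "Z = ray scale (scale a u + scale e v)" "a \<noteq> 0 \<or> e \<noteq> 0"
      using assms(3) seg_ray[OF uv(1,3)] uv by auto
    obtain c d where cd: "X = ray scale (scale c u + scale d v)" "c \<noteq> 0 \<or> d \<noteq> 0"
      using X seg_ray[OF uv(1,3)] uv by auto
    define z where "z = scale a u + scale e v"
    define x where "x = scale c u + scale d v"
    have z0: "z \<noteq> 0" and x0: "x \<noteq> 0"
      unfolding z_def x_def by (rule combination_nonzero[OF uv(1,3) Z(2)] combination_nonzero[OF uv(1,3) cd(2)])+
    have Zz: "Z = ray scale z" and Xx: "X = ray scale x" unfolding z_def x_def by (fact Z(1) cd(1))+
    show "X \<in> seg scale U Z \<union> seg scale Z V"
    proof (cases "a * d \<le> c * e")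
      case True
      show ?thesis
      proof (cases "e = 0")
        case True
        then have "Z = U" using Zz Z(2) ray_scale[OF uv(1)] uv(2)
          by (metis z_def add_0_right scale_zero_left)
        then show ?thesis using X by simp
      next
        case e: False
        have "scale (e * c) u + scale d z = scale (a * d) u + scale (c * e) u + scale (e * d) v"
          by (simp only: z_def scale_add_right scale_scale ac_simps)
        also have "\<dots> = scale e x"
          by (simp only: scale_absorb[OF True] x_def scale_add_right scale_scale mult.commute)
        finally have eq: "scale (e * c) u + scale d z = scale e x" .
        have "ray scale (scale (e * c) u + scale d z) = X"
          unfolding eq Xx by (rule ray_scale[OF x0 e])
        moreover have "e * c \<noteq> 0 \<or> d \<noteq> 0" using cd(2) bipotent_mult_nonzero[OF e] by blast
        ultimately show ?thesis using seg_ray[OF uv(1) z0] uv(2) Zz by blast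
      qed
    next
      case False
      then have le: "c * e \<le> a * d" by simp
      from False have a: "a \<noteq> 0" using bipotent_zero_le by (metis mult_zero_left)
      have "scale c z + scale (a * d) v = scale (a * c) u + (scale (c * e) v + scale (a * d) v)"
        by (simp only: z_def scale_add_right scale_scale ac_simps)
      also have "\<dots> = scale a x"
        by (simp only: scale_absorb[OF le] x_def scale_add_right scale_scale)
      finally have eq: "scale c z + scale (a * d) v = scale a x" .
      have "ray scale (scale c z + scale (a * d) v) = X"
        unfolding eq Xx by (rule ray_scale[OF x0 a])
      moreover have "c \<noteq> 0 \<or> a * d \<noteq> 0" using cd(2) bipotent_mult_nonzero[OF a] by blast
      ultimately show ?thesis using seg_ray[OF z0 uv(3)] uv(4) Zz by blast
    qed
  qed
qed

lemma separates_sym: "separates scale X Y A B Z \<Longrightarrow> separates scale Y X B A Z"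
  unfolding separates_def seg_ro_def seg_lo_def by (metis seg_sym)

lemma ray_less_imp_in_seg:
  "ray_less scale W X Y \<Longrightarrow> W \<in> rays scale \<Longrightarrow> X \<in> rays scale \<Longrightarrow> X \<in> seg scale W Y"
  unfolding ray_less_def ray_le_def using right_in_seg by blast


section \<open>Quasilinear forms\<close>

text \<open>A quasilinear form is a quadratic form that admits the companion \<open>0\<close>.\<close>

definition quasilinear :: "('v \<Rightarrow> 'r) \<Rightarrow> bool" where
  "quasilinear N \<longleftrightarrow> (\<forall>x y. N (x + y) = N x + N y) \<and> (\<forall>c x. N (scale c x) = c\<^sup>2 * N x)"

lemma quasilinear_combination:
  "quasilinear N \<Longrightarrow> N (scale c x + scale d y) = max (c\<^sup>2 * N x) (d\<^sup>2 * N y)"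
  unfolding quasilinear_def by (simp add: bipotent_add)

lemma quasilinear_le_combination:
  assumes "quasilinear N" "quasilinear M" "N x \<le> M x" "N y \<le> M y"
  shows "N (scale c x + scale d y) \<le> M (scale c x + scale d y)"
  unfolding quasilinear_combination[OF assms(1)] quasilinear_combination[OF assms(2)]
  using assms(3,4) by (intro max.mono bipotent_mult_left_mono)

lemma quasilinear_less_combination:
  assumes "quasilinear N" "quasilinear M" "N x < M x" "N y < M y" "c \<noteq> 0 \<or> d \<noteq> 0"
  shows "N (scale c x + scale d y) < M (scale c x + scale d y)"
proof -
  have *: "max (c\<^sup>2 * A) (d\<^sup>2 * B) < max (c\<^sup>2 * A') (d\<^sup>2 * B')"
    if lt: "A < A'" "B < B'" and c: "c \<noteq> 0" for c d A B A' B' :: 'r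
  proof -
    have A: "c\<^sup>2 * A < c\<^sup>2 * A'"
      by (rule bipotent_mult_strict_left_mono[OF lt(1) bipotent_square_nonzero[OF c]])
    show ?thesis
    proof (cases "d = 0")
      case True
      then have d: "d\<^sup>2 * B = 0" by simp
      have "0 < c\<^sup>2 * A'" using A bipotent_zero_le by (rule order.strict_trans1[rotated])
      then show ?thesis using A unfolding d by (simp add: less_max_iff_disj)
    next
      case False
      then show ?thesis
        using A bipotent_mult_strict_left_mono[OF lt(2) bipotent_square_nonzero[OF False]]
        by (intro max_less_iff_conj[THEN iffD2] conjI) (simp_all add: less_max_iff_disj)
    qed
  qed
  show ?thesis
    unfolding quasilinear_combination[OF assms(1)] quasilinear_combination[OF assms(2)]
  proof (cases "c = 0")
    case True
    with assms(5) have "d \<noteq> 0" by simp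
    from *[OF assms(4,3) this, of c]
    show "max (c\<^sup>2 * N x) (d\<^sup>2 * N y) < max (c\<^sup>2 * M x) (d\<^sup>2 * M y)"
      by (simp only: max.commute)
  qed (rule *[OF assms(3,4)])
qed

text \<open>
  With \<open>d\<close> chosen such that \<open>d\<^sup>2 N y = M x\<close>, the two smaller values \<open>N x\<close> and \<open>d\<^sup>2 M y\<close> are absorbed,
  and both forms take the value \<open>M x\<close> at \<open>x + d y\<close>.
\<close>

lemma quasilinear_crossing:
  assumes roots: "\<And>x::'r. \<exists>y. y\<^sup>2 = x"
    and "quasilinear N" "quasilinear M" "N x < M x" "M y < N y"
  shows "\<exists>d. N (scale 1 x + scale d y) = M (scale 1 x + scale d y)"
proof -
  have "N y \<noteq> 0" using assms(5) bipotent_zero_le by (metis not_less)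
  then obtain d where d: "d\<^sup>2 * N y = M x" using exists_square_multiple[OF roots] by metis
  have "d\<^sup>2 * M y \<le> M x" using bipotent_mult_left_mono[of "M y" "N y" "d\<^sup>2"] assms(5) d by simp
  then have "N (scale 1 x + scale d y) = M (scale 1 x + scale d y)"
    using assms(4) quasilinear_combination[OF assms(2), of 1 x d y]
      quasilinear_combination[OF assms(3), of 1 x d y] d by simp
  then show ?thesis ..
qed

end


section \<open>Basic functions as quotients of forms\<close>

context anisotropic_quadratic_module
begin

definition quasilinear_quotient :: "('v set \<Rightarrow> 'r) \<Rightarrow> bool" where
  "quasilinear_quotient f \<longleftrightarrow> (\<exists>N. quasilinear N \<and> (\<forall>x. x \<noteq> 0 \<longrightarrow> f (ray scale x) = N x / q x))"

text \<open>
  For a fixed vector \<open>y\<close>, the function \<open>x \<mapsto> b y x\<close> is linear, and squaring is additive, so the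
  numerator of each CS-ratio is a quasilinear form in \<open>x\<close>, over the common denominator \<open>q x\<close>.
\<close>

lemma basic_fun_quasilinear_quotient:
  assumes "basic_fun scale q b S f" "S \<subseteq> rays scale"
  shows "quasilinear_quotient f"
proof -
  obtain \<gamma> where \<gamma>: "\<And>X. X \<in> rays scale \<Longrightarrow> f X = (\<Sum>Y\<in>S. \<gamma> Y * CS q b Y X)"
    using assms(1) unfolding basic_fun_def by blast
  have "\<forall>Y\<in>S. \<exists>y. y \<noteq> 0 \<and> Y = ray scale y" using assms(2) raysE by (metis in_mono)
  then obtain r where r: "\<And>Y. Y \<in> S \<Longrightarrow> r Y \<noteq> 0 \<and> Y = ray scale (r Y)" by metis
  define N where "N x = (\<Sum>Y\<in>S. \<gamma> Y * ((b (r Y) x)\<^sup>2 * inverse (q (r Y))))" for x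
  have "N (x + y) = N x + N y" for x y
  proof -
    have "b (r Y) (x + y) = b (r Y) x + b (r Y) y" for Y
      by (metis b_sym b_add_left)
    then show ?thesis
      by (simp only: N_def bipotent_square_add distrib_left distrib_right sum.distrib)
  qed
  moreover have "N (scale c x) = c\<^sup>2 * N x" for c x
  proof -
    have "b (r Y) (scale c x) = c * b (r Y) x" for Y by (metis b_sym b_scale_left)
    then show ?thesis by (simp add: N_def power_mult_distrib sum_distrib_left ac_simps)
  qed
  ultimately have N: "quasilinear N" unfolding quasilinear_def by blast
  have "f (ray scale x) = N x / q x" if x: "x \<noteq> 0" for x
  proof -
    have "CS q b Y (ray scale x) = (b (r Y) x)\<^sup>2 * inverse (q (r Y)) * inverse (q x)" if Y: "Y \<in> S" for Y
    proof -
      have nz: "q (r Y) \<noteq> 0" "q x \<noteq> 0" using r[OF Y] x q_anisotropic by blast+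
      then have "q (r Y) * q x \<noteq> 0" by (rule bipotent_mult_nonzero)
      then have "inverse (q (r Y) * q x) = inverse (q (r Y)) * inverse (q x)"
      proof -
        have "q (r Y) * q x * (inverse (q (r Y)) * inverse (q x))
            = (inverse (q (r Y)) * q (r Y)) * (inverse (q x) * q x)" by (simp only: ac_simps)
        also have "\<dots> = 1" using nz by (simp add: bipotent_left_inverse)
        also have "\<dots> = q (r Y) * q x * inverse (q (r Y) * q x)"
          using bipotent_left_inverse[OF \<open>q (r Y) * q x \<noteq> 0\<close>] by (simp only: mult.commute)
        finally show ?thesis using bipotent_mult_left_cancel[OF \<open>q (r Y) * q x \<noteq> 0\<close>] by metis
      qed
      moreover have "CS q b Y (ray scale x) = (b (r Y) x)\<^sup>2 / (q (r Y) * q x)"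
        using CS_ray ray_self ray_in_rays r[OF Y] x by metis
      ultimately show ?thesis by (simp only: bipotent_divide_inverse mult.assoc)
    qed
    then have "f (ray scale x) = (\<Sum>Y\<in>S. \<gamma> Y * ((b (r Y) x)\<^sup>2 * inverse (q (r Y))) * inverse (q x))"
      using \<gamma>[OF ray_in_rays[OF x]] by (simp add: mult.assoc)
    then show ?thesis by (simp only: N_def bipotent_divide_inverse sum_distrib_right)
  qed
  with N show ?thesis unfolding quasilinear_quotient_def by blast
qed

lemma quasilinear_quotient_less_iff:
  assumes "\<forall>x. x \<noteq> 0 \<longrightarrow> f (ray scale x) = N x / q x" "\<forall>x. x \<noteq> 0 \<longrightarrow> g (ray scale x) = M x / q x"
    and "x \<noteq> 0"
  shows "f (ray scale x) < g (ray scale x) \<longleftrightarrow> N x < M x"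
  using assms bipotent_divide_less_iff[OF q_anisotropic[OF assms(3)]] by metis

lemma seg_less:
  assumes f: "quasilinear_quotient f" and g: "quasilinear_quotient g"
    and rays: "X \<in> rays scale" "Y \<in> rays scale" and less: "f X < g X" "f Y < g Y"
    and Z: "Z \<in> seg scale X Y"
  shows "f Z < g Z"
proof -
  obtain N where N: "quasilinear N" "\<forall>x. x \<noteq> 0 \<longrightarrow> f (ray scale x) = N x / q x"
    using f unfolding quasilinear_quotient_def by blast
  obtain M where M: "quasilinear M" "\<forall>x. x \<noteq> 0 \<longrightarrow> g (ray scale x) = M x / q x"
    using g unfolding quasilinear_quotient_def by blast
  note iff = quasilinear_quotient_less_iff[OF N(2) M(2)]
  obtain x y where xy: "x \<noteq> 0" "X = ray scale x" "y \<noteq> 0" "Y = ray scale y"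
    using rays raysE by metis
  obtain c d where cd: "c \<noteq> 0 \<or> d \<noteq> 0" "Z = ray scale (scale c x + scale d y)"
    using Z seg_ray[OF xy(1,3)] xy by auto
  have "N x < M x" "N y < M y" using less iff xy by auto
  then show ?thesis
    using quasilinear_less_combination[OF N(1) M(1) _ _ cd(1)] iff combination_nonzero[OF xy(1,3) cd(1)] cd(2)
    by metis
qed

lemma seg_le:
  assumes f: "quasilinear_quotient f" and g: "quasilinear_quotient g"
    and rays: "X \<in> rays scale" "Y \<in> rays scale" and le: "f X \<le> g X" "f Y \<le> g Y"
    and Z: "Z \<in> seg scale X Y"
  shows "f Z \<le> g Z"
proof -
  obtain N where N: "quasilinear N" "\<forall>x. x \<noteq> 0 \<longrightarrow> f (ray scale x) = N x / q x"
    using f unfolding quasilinear_quotient_def by blast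
  obtain M where M: "quasilinear M" "\<forall>x. x \<noteq> 0 \<longrightarrow> g (ray scale x) = M x / q x"
    using g unfolding quasilinear_quotient_def by blast
  note iff = quasilinear_quotient_less_iff[OF M(2) N(2)]
  obtain x y where xy: "x \<noteq> 0" "X = ray scale x" "y \<noteq> 0" "Y = ray scale y"
    using rays raysE by metis
  obtain c d where cd: "c \<noteq> 0 \<or> d \<noteq> 0" "Z = ray scale (scale c x + scale d y)"
    using Z seg_ray[OF xy(1,3)] xy by auto
  have "N x \<le> M x" "N y \<le> M y" using le iff xy by (metis not_less)+
  then have "N (scale c x + scale d y) \<le> M (scale c x + scale d y)"
    by (rule quasilinear_le_combination[OF N(1) M(1)])
  then show ?thesis
    using iff[OF combination_nonzero[OF xy(1,3) cd(1)]] cd(2) by (metis not_less)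
qed

lemma seg_eq:
  assumes "quasilinear_quotient f" "quasilinear_quotient g"
    and "X \<in> rays scale" "Y \<in> rays scale" "f X = g X" "f Y = g Y" "Z \<in> seg scale X Y"
  shows "f Z = g Z"
  using seg_le[of f g X Y Z] seg_le[of g f X Y Z] assms by (simp add: order_antisym)

lemma seg_crossing:
  assumes roots: "\<And>x::'r. \<exists>y. y\<^sup>2 = x"
    and f: "quasilinear_quotient f" and g: "quasilinear_quotient g"
    and rays: "X \<in> rays scale" "Y \<in> rays scale" and less: "f X < g X" "g Y < f Y"
  shows "\<exists>Z\<in>seg scale X Y. f Z = g Z"
proof -
  obtain N where N: "quasilinear N" "\<forall>x. x \<noteq> 0 \<longrightarrow> f (ray scale x) = N x / q x"
    using f unfolding quasilinear_quotient_def by blast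
  obtain M where M: "quasilinear M" "\<forall>x. x \<noteq> 0 \<longrightarrow> g (ray scale x) = M x / q x"
    using g unfolding quasilinear_quotient_def by blast
  obtain x y where xy: "x \<noteq> 0" "X = ray scale x" "y \<noteq> 0" "Y = ray scale y"
    using rays raysE by metis
  have "N x < M x" "M y < N y"
    using less quasilinear_quotient_less_iff[OF N(2) M(2)] quasilinear_quotient_less_iff[OF M(2) N(2)] xy
    by auto
  then obtain d where d: "N (scale 1 x + scale d y) = M (scale 1 x + scale d y)"
    using quasilinear_crossing[OF roots N(1) M(1)] by metis
  have nz: "1 \<noteq> (0::'r) \<or> d \<noteq> 0" by simp
  have "ray scale (scale 1 x + scale d y) \<in> seg scale X Y"
    using seg_ray[OF xy(1,3)] xy nz by blast
  moreover have "f (ray scale (scale 1 x + scale d y)) = g (ray scale (scale 1 x + scale d y))"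
    using N(2) M(2) d combination_nonzero[OF xy(1,3) nz] by metis
  ultimately show ?thesis by blast
qed

text \<open>
  The set \<open>{f < g}\<close> has no last ray on the way to a ray of \<open>{f = g}\<close>. Write \<open>f = N / q\<close> and
  \<open>g = M / q\<close>. If \<open>x + d y\<close> is a multiple of \<open>x\<close> and \<open>M (x + d y) = M x\<close>, then, as \<open>M x \<noteq> 0\<close>,
  \<open>N\<close> and \<open>q\<close> also take the same values at both vectors. A suitable \<open>d\<close> rules this out: if the common value of \<open>N\<close>
  and \<open>M\<close> at \<open>y\<close> is nonzero, density provides a \<open>d\<close> with \<open>N x < d\<^sup>2 N y < M x\<close>, which changes \<open>N\<close>;
  otherwise \<open>N\<close> and \<open>M\<close> do not notice \<open>y\<close> at all, but \<open>q\<close> does once \<open>d\<close> is large, because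
  \<open>q y \<noteq> 0\<close>.
\<close>

lemma no_last_less:
  assumes roots: "\<And>x::'r. \<exists>y. y\<^sup>2 = x"
    and f: "quasilinear_quotient f" and g: "quasilinear_quotient g"
    and rays: "X \<in> rays scale" "Y \<in> rays scale" and less: "f X < g X" and eq: "f Y = g Y"
  shows "\<exists>Z\<in>seg scale X Y. Z \<noteq> X \<and> f Z < g Z"
proof -
  obtain N where N: "quasilinear N" "\<forall>x. x \<noteq> 0 \<longrightarrow> f (ray scale x) = N x / q x"
    using f unfolding quasilinear_quotient_def by blast
  obtain M where M: "quasilinear M" "\<forall>x. x \<noteq> 0 \<longrightarrow> g (ray scale x) = M x / q x"
    using g unfolding quasilinear_quotient_def by blast
  note iff = quasilinear_quotient_less_iff[OF N(2) M(2)]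
  note iff' = quasilinear_quotient_less_iff[OF M(2) N(2)]
  obtain x y where xy: "x \<noteq> 0" "X = ray scale x" "y \<noteq> 0" "Y = ray scale y"
    using rays raysE by metis
  have NMx: "N x < M x" using less iff xy by auto
  have "\<not> N y < M y" "\<not> M y < N y"
    using eq iff[OF xy(3)] iff'[OF xy(3)] xy(4) by auto
  then have NMy: "N y = M y" by simp
  have Mx0: "M x \<noteq> 0" using NMx bipotent_zero_le by (metis not_less)
  have "\<exists>d. d\<^sup>2 * M y < M x \<and> (N x < d\<^sup>2 * N y \<or> q x < d\<^sup>2 * q y)"
  proof (cases "M y = 0")
    case True
    obtain u :: 'r where "1 < u" using exists_gt_one by blast
    then have "q x * 1 < q x * u" by (rule bipotent_mult_strict_left_mono[OF _ q_anisotropic[OF xy(1)]])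
    moreover obtain d where "d\<^sup>2 * q y = q x * u"
      using exists_square_multiple[OF roots q_anisotropic[OF xy(3)]] by metis
    ultimately have "q x < d\<^sup>2 * q y" by simp
    moreover have "d\<^sup>2 * M y < M x" using True Mx0 by (simp add: bipotent_pos_iff)
    ultimately show ?thesis by blast
  next
    case False
    obtain t where "N x < t" "t < M x" using bipotent_dense[OF roots NMx] .
    moreover obtain d where "d\<^sup>2 * M y = t" using exists_square_multiple[OF roots False] by metis
    ultimately show ?thesis unfolding NMy by blast
  qed
  then obtain d where d: "d\<^sup>2 * M y < M x" "N x < d\<^sup>2 * N y \<or> q x < d\<^sup>2 * q y" by blast
  define z where "z = scale 1 x + scale d y"
  have nz: "1 \<noteq> (0::'r) \<or> d \<noteq> 0" by simp
  have z0: "z \<noteq> 0" unfolding z_def by (rule combination_nonzero[OF xy(1,3) nz])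
  have Nz: "N z = max (N x) (d\<^sup>2 * N y)" unfolding z_def quasilinear_combination[OF N(1)] by simp
  have Mz: "M z = M x" unfolding z_def quasilinear_combination[OF M(1)] using d(1) by simp
  have qz: "d\<^sup>2 * q y \<le> q z" unfolding z_def q_add q_scale by (simp add: bipotent_add le_max_iff_disj)
  have "N z < M z" unfolding Nz Mz NMy using NMx d(1) by simp
  then have "f (ray scale z) < g (ray scale z)" using iff[OF z0] by blast
  moreover have "ray scale z \<noteq> X"
  proof
    assume "ray scale z = X"
    then obtain c where c: "z = scale c x" using ray_self[OF z0] xy mem_ray_iff[OF xy(1)] by auto
    then have "M x * c\<^sup>2 = M x * 1" using Mz M(1) unfolding quasilinear_def by (simp add: mult.commute)
    then have c1: "c\<^sup>2 = 1" using bipotent_mult_left_cancel[OF Mx0] by blast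
    then have "N z = N x" "q z = q x"
      using c N(1) q_scale[of c x] unfolding quasilinear_def by simp_all
    then show False using Nz qz d(2) by (metis max.cobounded2 not_less)
  qed
  moreover have "ray scale z \<in> seg scale X Y"
    unfolding z_def using seg_ray[OF xy(1,3)] xy nz by blast
  ultimately show ?thesis by blast
qed

text \<open>
  The separating ray belongs to \<open>{f = g}\<close>, since otherwise it would be the last ray of
  \<open>{f < g}\<close> on \<open>[P,Q]\<close>. On the way from \<open>W\<close> to \<open>Z\<close>, convexity gives \<open>f < g\<close> up to \<open>P\<close>, and from
  \<open>P\<close> on all rays but \<open>Z\<close> lie in \<open>A\<close>.
\<close>

lemma separating_ray_less_eq:
  assumes roots: "\<And>x::'r. \<exists>y. y\<^sup>2 = x"
    and f: "quasilinear_quotient f" and g: "quasilinear_quotient g"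
    and rays: "W \<in> rays scale" "P \<in> rays scale" "Q \<in> rays scale"
    and sep: "separates scale P Q A B Z"
    and A: "\<And>X. X \<in> A \<Longrightarrow> f X < g X" and B: "\<And>X. X \<in> B \<Longrightarrow> f X = g X"
    and "P \<in> A" "Q \<in> B" "P \<in> seg scale W Q" "f W < g W"
  shows "f Z = g Z" "Z \<in> seg scale P Q" "\<And>X. X \<in> seg_ro scale W Z \<Longrightarrow> f X < g X"
proof -
  have Zray: "Z \<in> rays scale" using sep unfolding separates_def by blast
  have "\<not> seg scale P Q \<inter> A = seg scale P Z" if "seg scale P Q \<inter> B = seg_lo scale Z Q"
  proof
    assume "seg scale P Q \<inter> A = seg scale P Z"
    then have "f Z < g Z" using right_in_seg[OF rays(2) Zray] A by blast
    then obtain X where "X \<in> seg scale Z Q" "X \<noteq> Z" "f X < g X"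
      using no_last_less[OF roots f g Zray rays(3)] B[OF \<open>Q \<in> B\<close>] by blast
    then have "X \<in> B" "f X < g X" using that unfolding seg_lo_def by blast+
    then show False using B by force
  qed
  then have *: "seg scale P Q \<inter> A = seg_ro scale P Z" "seg scale P Q \<inter> B = seg scale Z Q"
    using sep unfolding separates_def by blast+
  have Z: "Z \<in> seg scale P Q \<inter> B" using left_in_seg[OF Zray rays(3)] *(2) by simp
  then show "f Z = g Z" "Z \<in> seg scale P Q" using B by blast+
  have "P \<in> seg scale W Z" using seg_nested[OF rays(1,3)] \<open>P \<in> seg scale W Q\<close> Z by blast
  then have split: "seg scale W Z = seg scale W P \<union> seg scale P Z"
    by (rule seg_split[OF rays(1) Zray])
  fix X assume "X \<in> seg_ro scale W Z"
  then consider "X \<in> seg scale W P" | "X \<in> seg_ro scale P Z"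
    using split unfolding seg_ro_def by blast
  then show "f X < g X"
  proof cases
    case 1
    then show ?thesis using seg_less[OF f g rays(1,2) \<open>f W < g W\<close>] A[OF \<open>P \<in> A\<close>] by blast
  next
    case 2
    then show ?thesis using * A by blast
  qed
qed

end


section \<open>Sign changes along the sequence of strata\<close>

lemma stratum_sign:
  assumes "stratum scale m f A" "X \<in> A" "Y \<in> A" "i \<in> {1..m}" "j \<in> {1..m}"
  shows "f i X < f j X \<longleftrightarrow> f i Y < f j Y"
proof -
  obtain box :: "nat \<Rightarrow> nat \<Rightarrow> 'a \<Rightarrow> 'a \<Rightarrow> bool" where
    box: "\<And>k l. 1 \<le> k \<Longrightarrow> k < l \<Longrightarrow> l \<le> m \<Longrightarrow> box k l \<in> {(<), (=), (>)}"
    and A: "A = {X \<in> rays scale. \<forall>k l. 1 \<le> k \<and> k < l \<and> l \<le> m \<longrightarrow> box k l (f k X) (f l X)}"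
    using assms(1) unfolding stratum_def by blast
  have *: "(f k X < f l X \<longleftrightarrow> f k Y < f l Y) \<and> (f l X < f k X \<longleftrightarrow> f l Y < f k Y)"
    if "1 \<le> k" "k < l" "l \<le> m" for k l
  proof -
    have "box k l (f k X) (f l X)" "box k l (f k Y) (f l Y)"
      using that assms(2,3) unfolding A by blast+
    then show ?thesis using box[OF that] by auto
  qed
  consider "i = j" | "i < j" | "j < i" by linarith
  then show ?thesis using * assms(4,5) by cases auto
qed

lemma switching_index:
  fixes s :: nat
  assumes "D 0" "\<not> D s" and down: "\<forall>n\<le>s. \<forall>m<n. D n \<longrightarrow> D m"
  shows "\<exists>k>0. k \<le> s \<and> (\<forall>n<k. D n) \<and> (\<forall>n\<ge>k. n \<le> s \<longrightarrow> \<not> D n)"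
proof (intro exI conjI allI impI)
  let ?k = "LEAST n. \<not> D n"
  have k: "\<not> D ?k" using assms(2) by (rule LeastI)
  show "0 < ?k" using k assms(1) by (metis gr0I)
  show "?k \<le> s" using assms(2) by (rule Least_le)
  show "D n" if "n < ?k" for n using not_less_Least[OF that] by blast
  show "\<not> D n" if "?k \<le> n" "n \<le> s" for n using down k that by (metis le_less)
qed

lemma sign_sets_of_cover:
  fixes g h :: "'b \<Rightarrow> 'c::linorder"
  assumes "I = A \<union> B \<union> C" "I \<subseteq> R"
    and A: "\<forall>X\<in>A. g X < h X" and B: "\<forall>X\<in>B. g X = h X" and C: "\<forall>X\<in>C. h X < g X"
  shows "{X \<in> R. g X < h X} \<inter> I = A" "{X \<in> R. g X = h X} \<inter> I = B" "{X \<in> R. h X < g X} \<inter> I = C"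
proof -
  have "(g X < h X \<longleftrightarrow> X \<in> A) \<and> (g X = h X \<longleftrightarrow> X \<in> B) \<and> (h X < g X \<longleftrightarrow> X \<in> C)"
    if X: "X \<in> I" for X
  proof -
    consider "X \<in> A" | "X \<in> B" | "X \<in> C" using X assms(1) by blast
    then show ?thesis using A[rule_format, of X] B[rule_format, of X] C[rule_format, of X]
      by cases (metis less_asym less_irrefl)+
  qed
  then show "{X \<in> R. g X < h X} \<inter> I = A" "{X \<in> R. g X = h X} \<inter> I = B" "{X \<in> R. h X < g X} \<inter> I = C"
    using assms(1,2) by blast+
qed

theorem theorem3p13:
  fixes scale :: "'r::bipotent_semifield \<Rightarrow> 'v::comm_monoid_add \<Rightarrow> 'v"
    and q :: "'v \<Rightarrow> 'r" and b :: "'v \<Rightarrow> 'v \<Rightarrow> 'r"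
    and S :: "'v set set" and m :: nat and f :: "nat \<Rightarrow> 'v set \<Rightarrow> 'r"
    and W W' :: "'v set" and s :: nat and T :: "nat \<Rightarrow> 'v set set" and Z :: "nat \<Rightarrow> 'v set"
    and i j :: nat
  assumes root_closed: "\<forall>n>0. \<forall>x::'r. \<exists>y. y ^ n = x"
    and quadratic: "anisotropic_quadratic_module scale q b"
    and S: "finite S" "S \<subseteq> rays scale"
    and basic: "\<forall>k\<in>{1..m}. basic_fun scale q b S (f k)"
    and WW': "W \<in> rays scale" "W' \<in> rays scale"
    and not_single: "\<not> (\<exists>A. stratum scale m f A \<and> seg scale W W' \<subseteq> A)"
    and strata: "strata_sequence scale m f W W' s T"
    and separating: "separating_rays scale W W' s T Z"
    and ij: "i \<in> {1..m}" "j \<in> {1..m}" "i \<noteq> j"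
  shows
    "(f i W < f j W \<and> f i W' = f j W' \<longrightarrow>
       (\<exists>k. 0 < k \<and> k \<le> s \<and>
          (\<forall>X \<in> (\<Union>n\<in>{0..k-1}. T n). f i X < f j X) \<and>
          (\<forall>X \<in> (\<Union>n\<in>{k..s}. T n). f i X = f j X) \<and>
          {X \<in> rays scale. f i X < f j X} \<inter> seg scale W W' = seg_ro scale W (Z k) \<and>
          {X \<in> rays scale. f i X = f j X} \<inter> seg scale W W' = seg scale (Z k) W')) \<and>
     (f i W < f j W \<and> f i W' > f j W' \<longrightarrow>
       (\<exists>k l. 0 < k \<and> k < l \<and> l \<le> s \<and>
          (\<forall>X \<in> (\<Union>n\<in>{0..k-1}. T n). f i X < f j X) \<and>
          (\<forall>X \<in> (\<Union>n\<in>{k..l-1}. T n). f i X = f j X) \<and>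
          (\<forall>X \<in> (\<Union>n\<in>{l..s}. T n). f i X > f j X) \<and>
          {X \<in> rays scale. f i X < f j X} \<inter> seg scale W W' = seg_ro scale W (Z k) \<and>
          {X \<in> rays scale. f i X = f j X} \<inter> seg scale W W' = seg scale (Z k) (Z l) \<and>
          {X \<in> rays scale. f i X > f j X} \<inter> seg scale W W' = seg_lo scale (Z l) W'))"
proof -
  interpret anisotropic_quadratic_module scale q b by (rule quadratic)
  have roots: "\<exists>y. y\<^sup>2 = x" for x :: 'r using root_closed by simp
  have fi: "quasilinear_quotient (f i)" and fj: "quasilinear_quotient (f j)"
    using basic ij S(2) basic_fun_quasilinear_quotient by blast+
  obtain P where P0: "P 0 = W" and Ps: "P s = W'"
    and P: "\<And>n. n \<le> s \<Longrightarrow> P n \<in> seg scale W W' \<inter> T n"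
    and sep: "\<And>n. 0 < n \<Longrightarrow> n \<le> s \<Longrightarrow> separates scale (P (n - 1)) (P n) (T (n - 1)) (T n) (Z n)"
    using separating unfolding separating_rays_def by (auto simp: Suc_le_eq)
  have Pray: "P n \<in> rays scale" if "n \<le> s" for n
    using P[OF that] seg_subset_rays[OF WW'] by blast
  have Zray: "Z n \<in> rays scale" if "0 < n" "n \<le> s" for n
    using sep[OF that] unfolding separates_def by blast
  have str: "stratum scale m f (T n)" if "n \<le> s" for n
    using strata that unfolding strata_sequence_def by (metis (mono_tags, lifting) atLeastAtMost_iff imageI le0 mem_Collect_eq)
  have Pseg: "P n \<in> seg scale W (P n')" if "n < n'" "n' \<le> s" for n n'
  proof -
    have "ray_less scale W (P n) (P n')"
      using strata that P[of n] P[of n'] unfolding strata_sequence_def by auto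
    then show ?thesis using ray_less_imp_in_seg WW'(1) Pray that by simp
  qed
  have less_iff: "f i X < f j X \<longleftrightarrow> f i (P n) < f j (P n)" if "n \<le> s" "X \<in> T n" for n X
    using stratum_sign[OF str[OF that(1)] that(2) _ ij(1,2)] P[OF that(1)] by blast
  have gt_iff: "f j X < f i X \<longleftrightarrow> f j (P n) < f i (P n)" if "n \<le> s" "X \<in> T n" for n X
    using stratum_sign[OF str[OF that(1)] that(2) _ ij(2,1)] P[OF that(1)] by blast
  have eq_iff: "f i X = f j X \<longleftrightarrow> f i (P n) = f j (P n)" if "n \<le> s" "X \<in> T n" for n X
    using less_iff[OF that] gt_iff[OF that] by (metis less_irrefl linorder_less_linear)
  have PT: "P n \<in> T n" if "n \<le> s" for n using P[OF that] by blast
  have sub: "Z n \<in> seg scale W W'" if "Z n \<in> seg scale (P (n - 1)) (P n)" "n \<le> s" for n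
    using that seg_subset_seg[OF WW', of "P (n - 1)" "P n"] P[of n] P[of "n - 1"] by auto

  have less_down: "\<forall>n\<le>s. \<forall>a<n. f i (P n) < f j (P n) \<longrightarrow> f i (P a) < f j (P a)" if "f i W < f j W"
    using seg_less[OF fi fj WW'(1) Pray that] Pseg by blast
  have le_down: "\<forall>n\<le>s. \<forall>a<n. f i (P n) \<le> f j (P n) \<longrightarrow> f i (P a) \<le> f j (P a)" if "f i W < f j W"
    using seg_le[OF fi fj WW'(1) Pray less_imp_le[OF that]] Pseg by blast

  \<comment> \<open>\<open>enter\<close> treats a change from \<open><\<close> to \<open>=\<close>. The change from \<open>=\<close> to \<open>>\<close> in \<open>leave\<close> is the same
    situation seen from \<open>W'\<close>, with \<open>f i\<close> and \<open>f j\<close> exchanged.\<close>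
  have enter: "f i (Z k) = f j (Z k)" "Z k \<in> seg scale W W'"
      "\<forall>X\<in>seg_ro scale W (Z k). f i X < f j X"
    if W: "f i W < f j W" and k: "0 < k" "k \<le> s" "f i (P (k-1)) < f j (P (k-1))" "f i (P k) = f j (P k)" for k
  proof -
    have k1: "k - 1 < k" "k - 1 \<le> s" using k by simp_all
    have A: "\<And>X. X \<in> T (k - 1) \<Longrightarrow> f i X < f j X" using less_iff[OF k1(2)] k(3) by blast
    have B: "\<And>X. X \<in> T k \<Longrightarrow> f i X = f j X" using eq_iff[OF k(2)] k(4) by blast
    note Z = separating_ray_less_eq[OF roots fi fj WW'(1) Pray[OF k1(2)] Pray[OF k(2)]
        sep[OF k(1,2)] A B PT[OF k1(2)] PT[OF k(2)] Pseg[OF k1(1) k(2)] W]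
    show "f i (Z k) = f j (Z k)" "\<forall>X\<in>seg_ro scale W (Z k). f i X < f j X" using Z(1,3) by blast+
    show "Z k \<in> seg scale W W'" by (rule sub[OF Z(2) k(2)])
  qed

  have leave: "f i (Z l) = f j (Z l)" "Z l \<in> seg scale W W'"
      "\<forall>X\<in>seg_lo scale (Z l) W'. f j X < f i X"
    if W': "f j W' < f i W'" and l: "0 < l" "l \<le> s" "f i (P (l-1)) = f j (P (l-1))" "f j (P l) < f i (P l)" for l
  proof -
    have l1: "l - 1 < l" "l - 1 \<le> s" using l by simp_all
    have A: "\<And>X. X \<in> T l \<Longrightarrow> f j X < f i X" using gt_iff[OF l(2)] l(4) by blast
    have B: "\<And>X. X \<in> T (l - 1) \<Longrightarrow> f j X = f i X" using eq_iff[OF l1(2)] l(3) by metis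
    have "P l \<in> seg scale W' (P (l - 1))"
      using seg_nested[OF WW'(2,1), of "P l" "P (l - 1)"] Pseg[OF l1(1) l(2)] P[OF l(2)] seg_sym by blast
    note Z = separating_ray_less_eq[OF roots fj fi WW'(2) Pray[OF l(2)] Pray[OF l1(2)]
        separates_sym[OF sep[OF l(1,2)]] A B PT[OF l(2)] PT[OF l1(2)] this W']
    show "f i (Z l) = f j (Z l)" using Z(1) by simp
    show "\<forall>X\<in>seg_lo scale (Z l) W'. f j X < f i X"
      using Z(3) unfolding seg_lo_def seg_ro_def by (metis seg_sym)
    show "Z l \<in> seg scale W W'" using sub[OF _ l(2)] Z(2) seg_sym by metis
  qed

  show ?thesis
  proof (intro conjI impI)
    assume "f i W < f j W \<and> f i W' = f j W'"
    then have W: "f i W < f j W" and W': "f i W' = f j W'" by auto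
    have "f i (P 0) < f j (P 0)" "\<not> f i (P s) < f j (P s)" using W W' P0 Ps by simp_all
    from switching_index[of "\<lambda>n. f i (P n) < f j (P n)" s, OF this less_down[OF W]]
    obtain k where k': "0 < k" "k \<le> s" "\<forall>n<k. f i (P n) < f j (P n)"
      "\<forall>n\<ge>k. n \<le> s \<longrightarrow> \<not> f i (P n) < f j (P n)"
      by blast
    note k = k'(1,2) k'(3,4)[rule_format]
    \<comment> \<open>\<open>f i \<le> f j\<close> holds at both ends, hence on all of \<open>[W,W']\<close>, so only equality is left
      from \<open>k\<close> on.\<close>
    have keq: "f i (P n) = f j (P n)" if "k \<le> n" "n \<le> s" for n
      using seg_le[OF fi fj WW', of "P n"] W W' P[OF that(2)] k(4)[OF that] by force
    have Z: "f i (Z k) = f j (Z k)" "Z k \<in> seg scale W W'" "\<forall>X\<in>seg_ro scale W (Z k). f i X < f j X"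
      using enter[OF W k(1,2)] k(1,2) k(3)[of "k-1"] keq[of k] by simp_all
    have split: "seg scale W W' = seg_ro scale W (Z k) \<union> seg scale (Z k) W'"
      using seg_split[OF WW' Z(2)] left_in_seg[OF Zray[OF k(1,2)] WW'(2)]
      unfolding seg_ro_def by blast
    have E: "\<forall>X\<in>seg scale (Z k) W'. f i X = f j X"
      using seg_eq[OF fi fj Zray[OF k(1,2)] WW'(2) Z(1) W'] by blast
    have 1: "\<forall>X \<in> (\<Union>n\<in>{0..k-1}. T n). f i X < f j X"
    proof
      fix X assume "X \<in> (\<Union>n\<in>{0..k-1}. T n)"
      then obtain n where n: "n \<le> k - 1" "X \<in> T n" by auto
      then show "f i X < f j X" using k less_iff[of n X] by simp
    qed
    have 2: "\<forall>X \<in> (\<Union>n\<in>{k..s}. T n). f i X = f j X"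
      using keq eq_iff by (metis UN_E atLeastAtMost_iff)
    have "seg scale W W' = seg_ro scale W (Z k) \<union> seg scale (Z k) W' \<union> {}" using split by simp
    note 3 = sign_sets_of_cover[OF this seg_subset_rays[OF WW'] Z(3) E ball_empty[THEN iffD2, OF TrueI]]
    show "\<exists>k. 0 < k \<and> k \<le> s \<and>
          (\<forall>X \<in> (\<Union>n\<in>{0..k-1}. T n). f i X < f j X) \<and>
          (\<forall>X \<in> (\<Union>n\<in>{k..s}. T n). f i X = f j X) \<and>
          {X \<in> rays scale. f i X < f j X} \<inter> seg scale W W' = seg_ro scale W (Z k) \<and>
          {X \<in> rays scale. f i X = f j X} \<inter> seg scale W W' = seg scale (Z k) W'"
      by (intro exI[of _ k] conjI k(1,2) 1 2 3(1,2))
  next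
    assume "f i W < f j W \<and> f i W' > f j W'"
    then have W: "f i W < f j W" and W': "f j W' < f i W'" by auto
    have "f i (P 0) < f j (P 0)" "\<not> f i (P s) < f j (P s)" using W W' P0 Ps by simp_all
    from switching_index[of "\<lambda>n. f i (P n) < f j (P n)" s, OF this less_down[OF W]]
    obtain k where k': "0 < k" "k \<le> s" "\<forall>n<k. f i (P n) < f j (P n)"
      "\<forall>n\<ge>k. n \<le> s \<longrightarrow> \<not> f i (P n) < f j (P n)"
      by blast
    note k = k'(1,2) k'(3,4)[rule_format]
    have "f i (P 0) \<le> f j (P 0)" "\<not> f i (P s) \<le> f j (P s)" using W W' P0 Ps by simp_all
    from switching_index[of "\<lambda>n. f i (P n) \<le> f j (P n)" s, OF this le_down[OF W]]
    obtain l where l': "0 < l" "l \<le> s" "\<forall>n<l. f i (P n) \<le> f j (P n)"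
      "\<forall>n\<ge>l. n \<le> s \<longrightarrow> \<not> f i (P n) \<le> f j (P n)"
      by blast
    note l = l'(1,2) l'(3,4)[rule_format]
    have "k \<le> l" using k(3)[of l] l(2) l(4)[of l] by (metis le_refl not_le_imp_less order.strict_implies_order)
    have "k \<noteq> l"
    proof
      assume "k = l"
      \<comment> \<open>Then \<open><\<close> would switch to \<open>>\<close> between consecutive strata, which cover \<open>[P (k - 1), P k]\<close>
        and so leave no room for a crossing.\<close>
      have k1: "k - 1 \<le> s" using k by simp
      have s1: "f i (P (k - 1)) < f j (P (k - 1))" using k by simp
      have s2: "f j (P k) < f i (P k)" using l \<open>k = l\<close> by (metis le_refl not_less)
      obtain X where X: "X \<in> seg scale (P (k - 1)) (P k)" "f i X = f j X"
        using seg_crossing[OF roots fi fj Pray[OF k1] Pray[OF k(2)] s1 s2] by blast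
      have "Z k \<in> seg scale (P (k - 1)) (P k)"
        using sep[OF k(1,2)] left_in_seg[OF Zray[OF k(1,2)] Pray[OF k(2)]] right_in_seg[OF Pray[OF k1] Zray[OF k(1,2)]]
        unfolding separates_def by blast
      note seg_split[OF Pray[OF k1] Pray[OF k(2)] this]
      then have "X \<in> T (k - 1) \<union> T k"
        using X(1) sep[OF k(1,2)] left_in_seg[OF Zray[OF k(1,2)] Pray[OF k(2)]] right_in_seg[OF Pray[OF k1] Zray[OF k(1,2)]]
        unfolding separates_def seg_ro_def seg_lo_def by blast
      then show False using less_iff[OF k1, of X] gt_iff[OF k(2), of X] s1 s2 X(2) by auto
    qed
    with \<open>k \<le> l\<close> have kl: "k < l" by simp
    have meq: "f i (P n) = f j (P n)" if "k \<le> n" "n < l" for n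
      using k(4)[of n] l(3)[of n] l(2) that by (simp add: order_le_less)
    have lgt: "f j (P n) < f i (P n)" if "l \<le> n" "n \<le> s" for n
      using l(4)[OF that] by simp
    have Z: "f i (Z k) = f j (Z k)" "Z k \<in> seg scale W W'" "\<forall>X\<in>seg_ro scale W (Z k). f i X < f j X"
      using enter[OF W k(1,2)] k(1,2) k(3)[of "k-1"] meq[of k] kl by simp_all
    have Y: "f i (Z l) = f j (Z l)" "Z l \<in> seg scale W W'" "\<forall>X\<in>seg_lo scale (Z l) W'. f j X < f i X"
      using leave[OF W' l(1,2)] l(1,2) meq[of "l-1"] lgt[of l] kl by simp_all
    note Zk = Zray[OF k(1,2)] and Zl = Zray[OF l(1,2)]
    have E: "\<forall>X\<in>seg scale (Z k) (Z l). f i X = f j X"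
      using seg_eq[OF fi fj Zk Zl Z(1) Y(1)] by blast
    have split1: "seg scale W W' = seg scale W (Z l) \<union> seg_lo scale (Z l) W'"
      using seg_split[OF WW' Y(2)] right_in_seg[OF WW'(1) Zl] unfolding seg_lo_def by blast
    \<comment> \<open>\<open>Z k\<close> comes before \<open>Z l\<close>, because beyond \<open>Z l\<close> there is no equality.\<close>
    then have "Z k \<in> seg scale W (Z l)" using Z(1,2) Y(3) by fastforce
    then have "seg scale W (Z l) = seg_ro scale W (Z k) \<union> seg scale (Z k) (Z l)"
      using seg_split[OF WW'(1) Zl] left_in_seg[OF Zk Zl] unfolding seg_ro_def by blast
    with split1 have split: "seg scale W W' = seg_ro scale W (Z k) \<union> seg scale (Z k) (Z l) \<union> seg_lo scale (Z l) W'"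
      by simp
    have 1: "\<forall>X \<in> (\<Union>n\<in>{0..k-1}. T n). f i X < f j X"
    proof
      fix X assume "X \<in> (\<Union>n\<in>{0..k-1}. T n)"
      then obtain n where n: "n \<le> k - 1" "X \<in> T n" by auto
      then show "f i X < f j X" using k less_iff[of n X] by simp
    qed
    have 2: "\<forall>X \<in> (\<Union>n\<in>{k..l-1}. T n). f i X = f j X"
    proof
      fix X assume "X \<in> (\<Union>n\<in>{k..l-1}. T n)"
      then obtain n where n: "k \<le> n" "n \<le> l - 1" "X \<in> T n" by auto
      then show "f i X = f j X" using l(1,2) meq[of n] eq_iff[of n X] by simp
    qed
    have 3: "\<forall>X \<in> (\<Union>n\<in>{l..s}. T n). f i X > f j X"
      using lgt gt_iff by (metis UN_E atLeastAtMost_iff)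
    note 4 = sign_sets_of_cover[OF split seg_subset_rays[OF WW'] Z(3) E Y(3)]
    show "\<exists>k l. 0 < k \<and> k < l \<and> l \<le> s \<and>
          (\<forall>X \<in> (\<Union>n\<in>{0..k-1}. T n). f i X < f j X) \<and>
          (\<forall>X \<in> (\<Union>n\<in>{k..l-1}. T n). f i X = f j X) \<and>
          (\<forall>X \<in> (\<Union>n\<in>{l..s}. T n). f i X > f j X) \<and>
          {X \<in> rays scale. f i X < f j X} \<inter> seg scale W W' = seg_ro scale W (Z k) \<and>
          {X \<in> rays scale. f i X = f j X} \<inter> seg scale W W' = seg scale (Z k) (Z l) \<and>
          {X \<in> rays scale. f i X > f j X} \<inter> seg scale W W' = seg_lo scale (Z l) W'"
      by (intro exI[of _ k] exI[of _ l] conjI k(1) kl l(2) 1 2 3 4)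
  qed
qed

end
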